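(* Let $K\ge1$ be an integer with $K\equiv 3\pmod 6$, and let $p_1,\dots,p_r$ be the distinct primes dividing $K^2+4$. If $m>1$ is an integer with $\pi_K(m)=m$, then either $m=6$ or $m=12\cdot p_1^{j_1}\cdots p_r^{j_r}$ for some integers $j_1,\dots,j_r\ge0$.
   Context: The $K$-Fibonacci sequence is $F_{K,0}=0$, $F_{K,1}=1$, $F_{K,n}=K F_{K,n-1}+F_{K,n-2}$; for an integer $m>1$, $\pi_K(m)$ is the length of its shortest period modulo $m$. *)

theory Defs
  imports "HOL-Number_Theory.Cong"
begin

fun kfib :: "nat \<Rightarrow> nat \<Rightarrow> nat" where
  "kfib K 0 = 0"
| "kfib K (Suc 0) = 1"
| "kfib K (Suc (Suc n)) = K * kfib K (Suc n) + kfib K n"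

(* The recurrence is invertible modulo m, so the sequence is purely periodic:
   no preperiod is needed, and for m > 0 a positive period exists. *)
definition kfib_period :: "nat \<Rightarrow> nat \<Rightarrow> nat" where
  "kfib_period K m = (LEAST t. t > 0 \<and> (\<forall>n. [kfib K (n + t) = kfib K n] (mod m)))"

end

theory Submission
  imports Defs Complex_Main "HOL-Number_Theory.Residues"
begin

text \<open>
  Let \<open>D = K\<^sup>2 + 4\<close>. For a prime power \<open>q\<^sup>e\<close>, the period divides \<open>q\<^bsup>e-1\<^esup> T(q)\<close>, where \<open>T(2) = 3\<close>, \<open>T(3) = 2\<close>,
  \<open>T(q) = 4q\<close> if \<open>q\<close> divides \<open>D\<close>, and \<open>T(q) = 2(q \<plusminus> 1)\<close> otherwise. The period modulo \<open>m\<close> divides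
  the lcm of these numbers, so if it equals \<open>m\<close> and \<open>p\<close> is a prime factor of \<open>m\<close> not dividing \<open>T(p)\<close>,
  then the full power of \<open>p\<close> in \<open>m\<close> divides \<open>T(q)\<close> for another prime factor \<open>q\<close> of \<open>m\<close>. Hence
  \<open>m\<close> has no prime factor outside 2, 3 and the primes of \<open>D\<close>, is not divisible by 8 or by 9,
  and is even (Cassini) and divisible by 3 (as the period modulo 2 is 3). If some prime factor of \<open>D\<close> divides
  \<open>m\<close>, then 4 divides \<open>m\<close>, because the period modulo such a prime is a multiple of 4.
\<close>

section \<open>Identities\<close>

text \<open>The usual addition formulas, with F(a - 1) written as F(a + 1) - K F(a), so that no
  index is lowered; this subtraction is why the integers are used. Both formulas go through one
  induction on \<open>a\<close>, since each step needs the pair.\<close>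

lemma kfib_add:
  "int (kfib K (a + b)) = int (kfib K a) * int (kfib K (Suc b))
     + int (kfib K (Suc a)) * int (kfib K b) - int K * int (kfib K a) * int (kfib K b)"
  "int (kfib K (Suc (a + b))) = int (kfib K (Suc a)) * int (kfib K (Suc b))
     + int (kfib K a) * int (kfib K b)"
  by (induction a) (simp_all add: algebra_simps)

lemma kfib_cassini:
  "int (kfib K (Suc (Suc n))) * int (kfib K n) - (int (kfib K (Suc n)))\<^sup>2 = (-1) ^ Suc n"
  by (induction n) (simp_all add: algebra_simps power2_eq_square)

text \<open>Binet's formula with denominators cleared: the characteristic roots are
  \<open>(K + s) / 2\<close> and \<open>(K - s) / 2\<close>.\<close>

lemma kfib_binet:
  fixes s :: real
  assumes "s\<^sup>2 = real K ^ 2 + 4"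
  shows "2 ^ n * s * real (kfib K n) = (real K + s) ^ n - (real K - s) ^ n"
proof (induction n rule: induct_nat_012)
  case (ge2 n)
  \<comment> \<open>The doubled roots \<open>K + s\<close> and \<open>K - s\<close> satisfy the
    quadratic equation assumed here, so their powers obey the recurrence of
    \<open>2 ^ n * kfib K n\<close>.\<close>
  have rec: "x ^ Suc (Suc n) = 2 * real K * x ^ Suc n + 4 * x ^ n"
    if "x\<^sup>2 = 2 * real K * x + 4" for x :: real
  proof -
    have "x ^ Suc (Suc n) = x\<^sup>2 * x ^ n"
      by (simp add: power2_eq_square)
    also have "\<dots> = 2 * real K * x ^ Suc n + 4 * x ^ n"
      by (simp add: that algebra_simps)
    finally show ?thesis .
  qed
  have "2 ^ Suc (Suc n) * s * real (kfib K (Suc (Suc n)))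
      = 2 * real K * (2 ^ Suc n * s * real (kfib K (Suc n))) + 4 * (2 ^ n * s * real (kfib K n))"
    by (simp add: algebra_simps)
  also have "\<dots> = (real K + s) ^ Suc (Suc n) - (real K - s) ^ Suc (Suc n)"
  proof -
    have "(real K + s)\<^sup>2 = 2 * real K * (real K + s) + 4"
      "(real K - s)\<^sup>2 = 2 * real K * (real K - s) + 4"
      using assms by (simp_all add: power2_eq_square algebra_simps)
    from this[THEN rec] show ?thesis
      unfolding ge2.IH by (simp only: algebra_simps)
  qed
  finally show ?case .
qed auto

text \<open>In Binet's formula even powers of \<open>s\<close> cancel and odd ones double; dividing
  by \<open>s\<close> leaves powers of D, hence an identity of natural numbers.\<close>

lemma kfib_binomial_sum:
  "2 ^ n * kfib K n =
     (\<Sum>i\<le>n. (n choose i) * K ^ (n - i) * (if odd i then 2 * (K\<^sup>2 + 4) ^ (i div 2) else 0))"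
proof -
  define s where "s = sqrt (real K ^ 2 + 4)"
  have s2: "s\<^sup>2 = real K ^ 2 + 4"
    by (simp add: s_def)
  have "s > 0"
    unfolding s_def by (simp add: add_nonneg_pos)
  have pow: "s ^ i - (- s) ^ i = s * (if odd i then 2 * (real K ^ 2 + 4) ^ (i div 2) else 0)" for i
  proof (cases "odd i")
    case True
    then obtain j where "i = 2 * j + 1" by (elim oddE)
    then show ?thesis by (simp add: power_mult s2)
  qed simp
  have "s * (2 ^ n * real (kfib K n)) = (s + real K) ^ n - (- s + real K) ^ n"
    using kfib_binet[OF s2, of n] by (simp add: algebra_simps)
  also have "\<dots> = (\<Sum>i\<le>n. real (n choose i) * real K ^ (n - i) * (s ^ i - (- s) ^ i))"
    unfolding binomial_ring by (simp add: algebra_simps sum_subtractf)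
  also have "\<dots> = s * (\<Sum>i\<le>n. real (n choose i) * real K ^ (n - i)
      * (if odd i then 2 * (real K ^ 2 + 4) ^ (i div 2) else 0))"
    unfolding pow sum_distrib_left by (intro sum.cong) (auto simp: algebra_simps)
  finally have "2 ^ n * real (kfib K n) = (\<Sum>i\<le>n. real (n choose i) * real K ^ (n - i)
      * (if odd i then 2 * (real K ^ 2 + 4) ^ (i div 2) else 0))"
    using \<open>s > 0\<close> by simp
  also have "\<dots> = real (\<Sum>i\<le>n. (n choose i) * K ^ (n - i)
      * (if odd i then 2 * (K\<^sup>2 + 4) ^ (i div 2) else 0))"
    unfolding of_nat_sum by (intro sum.cong) auto
  finally have "real (2 ^ n * kfib K n) = real (\<Sum>i\<le>n. (n choose i) * K ^ (n - i)
      * (if odd i then 2 * (K\<^sup>2 + 4) ^ (i div 2) else 0))"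
    by simp
  then show ?thesis
    by (simp only: of_nat_eq_iff)
qed

text \<open>The prime \<open>q\<close> divides the binomial coefficients with
  \<open>0 < i < q\<close>, and the term \<open>i = 0\<close> vanishes by parity, so only
  \<open>i = q\<close> survives.\<close>

lemma kfib_prime_cong:
  assumes "prime q" "odd q"
  shows "[2 ^ q * kfib K q = 2 * (K\<^sup>2 + 4) ^ (q div 2)] (mod q)"
proof -
  let ?t = "\<lambda>i. (q choose i) * K ^ (q - i) * (if odd i then 2 * (K\<^sup>2 + 4) ^ (i div 2) else 0)"
  have "(\<Sum>i\<le>q. ?t i) = (\<Sum>i<q. ?t i) + ?t q"
    by (simp add: lessThan_Suc_atMost[symmetric])
  moreover have "q dvd (\<Sum>i<q. ?t i)"
  proof (intro dvd_sum)
    fix i assume i: "i \<in> {..<q}"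
    show "q dvd ?t i"
    proof (cases "i = 0")
      case False
      then have "q dvd (q choose i)"
        using i assms by (intro dvd_choose_prime) auto
      then show ?thesis by simp
    qed simp
  qed
  ultimately show ?thesis
    unfolding kfib_binomial_sum using assms
    by (auto simp: cong_def elim!: dvdE)
qed

text \<open>Every term with odd \<open>i > 1\<close> contains a factor D, so only
  \<open>i = 1\<close> survives. This is Binet's formula for a double root.\<close>

lemma kfib_cong_discriminant:
  "[2 ^ n * kfib K n = 2 * n * K ^ (n - 1)] (mod (K\<^sup>2 + 4))"
proof (cases "n = 0")
  case False
  let ?t = "\<lambda>i. (n choose i) * K ^ (n - i) * (if odd i then 2 * (K\<^sup>2 + 4) ^ (i div 2) else 0)"
  have "(\<Sum>i\<le>n. ?t i) = ?t 1 + (\<Sum>i\<in>{..n} - {1}. ?t i)"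
    using False by (intro sum.remove) auto
  moreover have "K\<^sup>2 + 4 dvd (\<Sum>i\<in>{..n} - {1}. ?t i)"
  proof (intro dvd_sum)
    fix i assume i: "i \<in> {..n} - {1}"
    show "K\<^sup>2 + 4 dvd ?t i"
    proof (cases "odd i")
      case True
      then have "i div 2 \<noteq> 0"
        using i by (auto elim: oddE)
      then show ?thesis by (simp add: dvd_power)
    qed simp
  qed
  moreover have "?t 1 = 2 * n * K ^ (n - 1)"
    by simp
  ultimately show ?thesis
    unfolding kfib_binomial_sum
    by (metis (no_types, lifting) cong_add_lcancel_0_nat cong_0_iff)
qed simp

section \<open>Periods\<close>

text \<open>Says that \<open>t\<close> is a period modulo \<open>m\<close>, not necessarily the
  least and possibly 0; one pair of consecutive values determines the whole sequence.\<close>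

definition kfib_returns :: "nat \<Rightarrow> nat \<Rightarrow> nat \<Rightarrow> bool" where
  "kfib_returns K m t \<longleftrightarrow>
     int m dvd int (kfib K t) \<and> int m dvd int (kfib K (Suc t)) - 1"

lemma kfib_returns_iff_period:
  "kfib_returns K m t \<longleftrightarrow> (\<forall>n. [kfib K (n + t) = kfib K n] (mod m))"
proof
  assume t: "kfib_returns K m t"
  show "\<forall>n. [kfib K (n + t) = kfib K n] (mod m)"
  proof
    fix n
    show "[kfib K (n + t) = kfib K n] (mod m)"
    proof (induction n rule: induct_nat_012)
      case 0
      show ?case
        using t by (simp add: kfib_returns_def cong_0_iff)
    next
      case 1
      have "[int (kfib K (Suc t)) = int 1] (mod int m)"
        using t by (simp add: kfib_returns_def cong_iff_dvd_diff)
      then show ?case by (simp only: cong_int_iff) simp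
    next
      case (ge2 n)
      then show ?case by (auto intro!: cong_add cong_mult)
    qed
  qed
next
  assume *: "\<forall>n. [kfib K (n + t) = kfib K n] (mod m)"
  have "[int (kfib K (Suc t)) = int 1] (mod int m)"
    using *[rule_format, of 1] by (simp only: cong_int_iff) simp
  then show "kfib_returns K m t"
    using *[rule_format, of 0] by (simp add: kfib_returns_def cong_0_iff cong_iff_dvd_diff)
qed

section \<open>Dependence of the periods on the modulus\<close>

lemma kfib_returns_modulus_dvd:
  assumes "kfib_returns K m t" "d dvd m"
  shows "kfib_returns K d t"
  using assms unfolding kfib_returns_def by (meson dvd_trans int_dvd_int_iff)

lemma kfib_returns_dvd:
  assumes "kfib_returns K m t" "t dvd s"
  shows "kfib_returns K m s"
proof -
  have "kfib_returns K m (t * c)" for c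
  proof (induction c)
    case (Suc c)
    show ?case
      unfolding kfib_returns_iff_period
    proof
      fix n
      have "[kfib K (n + t * c + t) = kfib K (n + t * c)] (mod m)"
        using assms(1) by (simp only: kfib_returns_iff_period)
      moreover have "[kfib K (n + t * c) = kfib K n] (mod m)"
        using Suc by (simp only: kfib_returns_iff_period)
      ultimately show "[kfib K (n + t * Suc c) = kfib K n] (mod m)"
        by (simp add: algebra_simps) (metis cong_trans)
    qed
  qed (simp add: kfib_returns_def)
  with assms(2) show ?thesis by (auto elim: dvdE)
qed

lemma kfib_returns_coprime_mult:
  assumes "coprime a b" "kfib_returns K a t" "kfib_returns K b t"
  shows "kfib_returns K (a * b) t"
  using assms unfolding kfib_returns_def
  by (simp add: divides_mult)

text \<open>A positive \<open>s\<close> makes the \<open>LEAST\<close> meaningful. Reducing a period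
  \<open>t\<close> modulo the least one \<open>l\<close> gives a period below \<open>l\<close>,
  which must be 0.\<close>

lemma kfib_period_properties:
  assumes "kfib_returns K m s" "s > 0"
  shows "kfib_returns K m (kfib_period K m)"
    and "kfib_returns K m t \<Longrightarrow> kfib_period K m dvd t"
proof -
  define l where "l = kfib_period K m"
  have l_eq: "l = (LEAST t. t > 0 \<and> kfib_returns K m t)"
    by (simp add: l_def kfib_period_def kfib_returns_iff_period)
  have l: "l > 0 \<and> kfib_returns K m l"
    unfolding l_eq by (rule LeastI[of _ s]) (use assms in auto)
  then show "kfib_returns K m (kfib_period K m)"
    by (simp add: l_def)
  assume t: "kfib_returns K m t"
  have "kfib_returns K m (t mod l)"
    unfolding kfib_returns_iff_period
  proof
    fix n
    have "kfib_returns K m (l * (t div l))"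
      using l by (auto intro: kfib_returns_dvd)
    then have "[kfib K (n + t mod l + l * (t div l)) = kfib K (n + t mod l)] (mod m)"
      by (simp only: kfib_returns_iff_period)
    then have "[kfib K (n + t mod l) = kfib K (n + t)] (mod m)"
      by (simp add: add.assoc cong_sym)
    also have "[kfib K (n + t) = kfib K n] (mod m)"
      using t by (simp only: kfib_returns_iff_period)
    finally show "[kfib K (n + t mod l) = kfib K n] (mod m)" .
  qed
  moreover have "t mod l < l"
    using l by simp
  ultimately have "t mod l = 0"
    using not_less_Least[of "t mod l" "\<lambda>t. t > 0 \<and> kfib_returns K m t"] l_eq by auto
  then show "kfib_period K m dvd t"
    by (simp add: l_def mod_eq_0_iff_dvd)
qed

text \<open>To first order in \<open>M\<close>, the pair \<open>(F(jt), F(jt + 1) - 1)\<close> is linear in \<open>j\<close>.\<close>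

lemma kfib_returns_lift:
  assumes "kfib_returns K M t" "p dvd M"
  shows "kfib_returns K (p * M) (p * t)"
proof -
  obtain u where u: "int (kfib K t) = int M * u"
    using assms(1) unfolding kfib_returns_def by (meson dvdE)
  obtain v where v: "int (kfib K (Suc t)) = 1 + int M * v"
    using assms(1) unfolding kfib_returns_def by (metis dvdE diff_add_cancel add.commute)
  have "\<exists>x y. int (kfib K (j * t)) = int j * int M * u + (int M)\<^sup>2 * x
      \<and> int (kfib K (Suc (j * t))) = 1 + int j * int M * v + (int M)\<^sup>2 * y" for j
  proof (induction j)
    case 0
    show ?case by simp
  next
    case (Suc j)
    then obtain x y where x: "int (kfib K (j * t)) = int j * int M * u + (int M)\<^sup>2 * x"
      and y: "int (kfib K (Suc (j * t))) = 1 + int j * int M * v + (int M)\<^sup>2 * y"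
      by blast
    have "int (kfib K (j * t + t)) = int (Suc j) * int M * u + (int M)\<^sup>2 *
        (x + 2 * int j * u * v + int M * x * v + int M * y * u - int K * int j * u\<^sup>2
          - int K * int M * x * u)"
      unfolding kfib_add(1) u v x y by (simp add: power2_eq_square algebra_simps)
    moreover have "int (kfib K (Suc (j * t + t))) = 1 + int (Suc j) * int M * v + (int M)\<^sup>2 *
        (y + int j * v\<^sup>2 + int M * y * v + int j * u\<^sup>2 + int M * x * u)"
      unfolding kfib_add(2) u v x y by (simp add: power2_eq_square algebra_simps)
    ultimately show ?case
      by (metis mult_Suc add.commute)
  qed
  from this[of p] obtain x y where
    x: "int (kfib K (p * t)) = int p * int M * u + (int M)\<^sup>2 * x" and
    y: "int (kfib K (Suc (p * t))) = 1 + int p * int M * v + (int M)\<^sup>2 * y"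
    by blast
  \<comment> \<open>At \<open>j = p\<close> the linear terms carry the factor \<open>p * M\<close>;
    since \<open>p\<close> divides \<open>M\<close>, the quadratic error terms do too.\<close>
  have "int (p * M) dvd (int M)\<^sup>2"
    using assms(2) by (simp add: power2_eq_square mult_dvd_mono)
  then show ?thesis
    unfolding kfib_returns_def x y by (simp add: dvd_add)
qed

text \<open>Iterated lifting: each further factor \<open>p\<close> in the modulus costs one factor
  \<open>p\<close> in the period.\<close>

lemma kfib_returns_prime_power:
  assumes "kfib_returns K p t"
  shows "kfib_returns K (p ^ Suc k) (p ^ k * t)"
proof (induction k)
  case (Suc k)
  have "kfib_returns K (p * p ^ Suc k) (p * (p ^ k * t))"
    using Suc by (rule kfib_returns_lift) simp
  then show ?case by (simp add: mult.assoc)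
qed (use assms in simp)

lemma kfib_returns_prod:
  assumes "finite A" "\<And>a. a \<in> A \<Longrightarrow> kfib_returns K (f a) t"
    and "\<And>a b. a \<in> A \<Longrightarrow> b \<in> A \<Longrightarrow> a \<noteq> b \<Longrightarrow> coprime (f a) (f b)"
  shows "kfib_returns K (\<Prod>a\<in>A. f a) t"
  using assms
proof (induction A rule: finite_induct)
  case empty
  show ?case by (simp add: kfib_returns_def)
next
  case (insert a A)
  have "coprime (f a) (\<Prod>a\<in>A. f a)"
    using insert by (intro prod_coprime_right) auto
  moreover have "kfib_returns K (f a) t" "kfib_returns K (\<Prod>a\<in>A. f a) t"
    using insert by auto
  ultimately show ?case
    using insert.hyps by (simp add: kfib_returns_coprime_mult)
qed

text \<open>For odd \<open>t\<close>, Cassini's identity reads -1 = 1 modulo \<open>m\<close>, which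
  forces \<open>m\<close> to divide 2.\<close>

lemma kfib_returns_even:
  assumes "kfib_returns K m t" "m > 2"
  shows "even t"
proof (rule ccontr)
  assume "odd t"
  define a where "a = int (kfib K (Suc t))"
  have "int m dvd int (kfib K t)" "int m dvd a - 1"
    using assms by (auto simp: kfib_returns_def a_def)
  moreover have "int (kfib K (Suc (Suc t))) * int (kfib K t) - a\<^sup>2 = 1"
    using kfib_cassini[of K t] \<open>odd t\<close> unfolding a_def by simp
  then have "2 = int (kfib K (Suc (Suc t))) * int (kfib K t) - (a - 1) * (a + 1)"
    by (simp add: algebra_simps power2_eq_square)
  ultimately have "int m dvd 2"
    by (metis dvd_diff dvd_mult dvd_mult2)
  then show False
    using assms(2) by (auto dest: zdvd_imp_le)
qed

lemma kfib_double_dvd: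
  assumes "d dvd int (kfib K n)"
  shows "d dvd int (kfib K (2 * n))"
  unfolding mult_2 kfib_add(1) by (intro dvd_add dvd_diff dvd_mult assms dvd_mult2[OF assms])

text \<open>By addition, F(2n + 1) = F(n + 1)^2 + F(n)^2, so a zero at \<open>n\<close> followed by
  a square root of 1 suffices.\<close>

lemma kfib_returns_double:
  assumes "int m dvd int (kfib K n)" "int m dvd (int (kfib K (Suc n)))\<^sup>2 - 1"
  shows "kfib_returns K m (2 * n)"
proof -
  have "int (kfib K (Suc (2 * n))) - 1
      = ((int (kfib K (Suc n)))\<^sup>2 - 1) + int (kfib K n) * int (kfib K n)"
    using kfib_add(2)[of K n n] by (simp add: mult_2 power2_eq_square)
  then have "int m dvd int (kfib K (Suc (2 * n))) - 1"
    using assms by (simp only: dvd_add dvd_mult2)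
  moreover have "int m dvd int (kfib K (2 * n))"
    using assms(1) by (rule kfib_double_dvd)
  ultimately show ?thesis by (simp add: kfib_returns_def)
qed

section \<open>Periods modulo primes\<close>

text \<open>Here \<open>q\<close> divides F(q), and Cassini makes F(q + 1) a square root of -1
  modulo \<open>q\<close>. One doubling turns it into -1, a second one into 1, whence the factor
  4.\<close>

lemma kfib_returns_dvd_discriminant:
  assumes "prime q" "odd q" "q dvd K\<^sup>2 + 4"
  shows "kfib_returns K q (4 * q)"
proof -
  obtain n where n: "q = Suc n"
    using assms(2) by (cases q) auto
  have "n > 0" "even n"
    using assms n prime_gt_1_nat[of q] by auto
  then have "q div 2 > 0"
    using n by auto
  then have "q dvd 2 * (K\<^sup>2 + 4) ^ (q div 2)"
    using assms(3) by (meson dvd_mult dvd_power dvd_trans)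
  then have "q dvd 2 ^ q * kfib K q"
    using kfib_prime_cong[OF assms(1,2), of K] cong_dvd_iff by metis
  moreover have "coprime q (2 ^ q)"
    using assms(2) by simp
  ultimately have "q dvd kfib K q"
    by (simp add: coprime_dvd_mult_right_iff)
  then have zero: "int q dvd int (kfib K q)"
    by simp
  define a where "a = int (kfib K (Suc q))"
  have "int (kfib K n) = a - int K * int (kfib K q)"
    by (simp add: a_def n)
  then have "a * (a - int K * int (kfib K q)) - (int (kfib K q))\<^sup>2 = - 1"
    using kfib_cassini[of K n] assms(2) by (simp only: n[symmetric] a_def) simp
  then have "a\<^sup>2 + 1 = int (kfib K q) * (a * int K + int (kfib K q))"
    by (simp add: power2_eq_square algebra_simps)
  then have neg: "int q dvd a\<^sup>2 + 1"
    using zero by simp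
  have 1: "int q dvd int (kfib K (2 * q))"
    using zero by (rule kfib_double_dvd)
  have "int (kfib K (Suc (2 * q))) + 1 = (a\<^sup>2 + 1) + int (kfib K q) * int (kfib K q)"
    using kfib_add(2)[of K q q] by (simp add: mult_2 a_def power2_eq_square)
  then have "int q dvd int (kfib K (Suc (2 * q))) + 1"
    using zero neg by (simp only: dvd_add dvd_mult)
  moreover have "x\<^sup>2 - 1 = (x + 1) * (x - 1)" for x :: int
    by (simp add: power2_eq_square algebra_simps)
  ultimately have "int q dvd (int (kfib K (Suc (2 * q))))\<^sup>2 - 1"
    by simp
  from kfib_returns_double[OF 1 this] show ?thesis by simp
qed

text \<open>Fermat gives F(q)^2 = 1 modulo \<open>q\<close>, so by Cassini \<open>q\<close> divides
  F(q - 1) F(q + 1). Doubling at whichever index is a zero gives the two alternatives.\<close>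

lemma kfib_returns_not_dvd_discriminant:
  assumes "prime q" "odd q" "\<not> q dvd K\<^sup>2 + 4"
  shows "kfib_returns K q (2 * (q - 1)) \<or> kfib_returns K q (2 * (q + 1))"
proof -
  define D where "D = K\<^sup>2 + 4"
  obtain n where n: "q = Suc n"
    using assms(2) by (cases q) auto
  have "even n"
    using assms n by auto
  have "\<not> q dvd 2"
    using assms primes_dvd_imp_eq[of q 2] by auto
  have fermat: "[2 ^ n = 1] (mod q)" "[D ^ n = 1] (mod q)"
    using fermat_theorem[of q 2] fermat_theorem[of q D] assms \<open>\<not> q dvd 2\<close>
    by (auto simp: D_def n)
  \<comment> \<open>Squaring turns the exponent (q - 1)/2 of D into q - 1, so Fermat applies and no
    Legendre symbol is needed.\<close>
  have "[(2 ^ q * kfib K q)\<^sup>2 = (2 * D ^ (q div 2))\<^sup>2] (mod q)"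
    unfolding D_def by (intro cong_pow kfib_prime_cong assms)
  moreover have "(2 ^ q * kfib K q)\<^sup>2 = 4 * (2 ^ n * 2 ^ n * (kfib K q)\<^sup>2)"
    by (subst (1) n) (simp add: power2_eq_square)
  moreover have "(2 * D ^ (q div 2))\<^sup>2 = 4 * D ^ n"
    using \<open>even n\<close> n by (simp add: power_mult_distrib flip: power_mult)
  ultimately have "[4 * (2 ^ n * 2 ^ n * (kfib K q)\<^sup>2) = 4 * D ^ n] (mod q)"
    by simp
  moreover have "coprime 4 q"
    using assms(2) coprime_power_left_iff[of 2 2 q] by simp
  ultimately have "[2 ^ n * 2 ^ n * (kfib K q)\<^sup>2 = D ^ n] (mod q)"
    by (subst (asm) cong_mult_lcancel_nat)
  moreover have "[2 ^ n * 2 ^ n * (kfib K q)\<^sup>2 = 1 * 1 * (kfib K q)\<^sup>2] (mod q)"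
    by (intro cong_mult fermat cong_refl)
  ultimately have "[(kfib K q)\<^sup>2 = 1] (mod q)"
    using fermat(2) by (metis cong_sym cong_trans mult_1)
  then have "[int ((kfib K q)\<^sup>2) = int 1] (mod int q)"
    by (simp only: cong_int_iff)
  then have sq: "int q dvd (int (kfib K q))\<^sup>2 - 1"
    by (simp add: cong_iff_dvd_diff)
  have "int (kfib K (Suc q)) * int (kfib K n) = (int (kfib K q))\<^sup>2 - 1"
    using kfib_cassini[of K n] assms(2) by (simp only: n[symmetric]) simp
  then have "int q dvd int (kfib K (Suc q)) * int (kfib K n)"
    using sq by simp
  then consider "int q dvd int (kfib K n)" | "int q dvd int (kfib K (Suc q))"
    using assms(1) by (metis prime_dvd_mult_iff prime_nat_int_transfer)
  then show ?thesis
  proof cases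
    case 1
    then have "kfib_returns K q (2 * n)"
      using sq by (intro kfib_returns_double) (simp_all only: n)
    then show ?thesis by (simp add: n)
  next
    case 2
    define b where "b = int (kfib K (Suc q))"
    \<comment> \<open>Since \<open>b\<close> vanishes modulo \<open>q\<close>, F(q + 2) = K b + F(q)
      is congruent to F(q), whose square is 1.\<close>
    have "(int (kfib K (Suc (Suc q))))\<^sup>2 - 1
        = ((int (kfib K q))\<^sup>2 - 1) + b * (int K * int K * b + 2 * int K * int (kfib K q))"
      by (simp add: b_def power2_eq_square algebra_simps)
    then have "int q dvd (int (kfib K (Suc (Suc q))))\<^sup>2 - 1"
      using sq 2 by (simp only: b_def) simp
    then have "kfib_returns K q (2 * Suc q)"
      by (rule kfib_returns_double[OF 2])
    then show ?thesis by simp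
  qed
qed

text \<open>Modulo \<open>q\<close> the double-root formula applies: F(t) = 0 forces
  \<open>q\<close> to divide \<open>t\<close>, and then F(t + 1) = 1 gives 2^t = K^t. With
  \<open>t = 2 * s\<close> and K^2 = -4 this is 4^s = (-4)^s, so \<open>s\<close> is even.\<close>

lemma four_dvd_if_kfib_returns:
  assumes "prime q" "odd q" "q dvd K\<^sup>2 + 4" "kfib_returns K q t"
  shows "4 dvd t"
proof -
  have "q > 2"
    using assms prime_gt_1_nat[of q] by (cases "q = 2") auto
  have cop2: "coprime q 2"
    using assms(2) by simp
  have "\<not> q dvd K"
  proof
    assume "q dvd K"
    then have "q dvd 4"
      using assms(3) by (metis dvd_add_right_iff dvd_trans dvd_power pos2)
    then have "q dvd 2 ^ 2" by simp
    then show False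
      using assms(1) \<open>q > 2\<close> by (metis prime_dvd_power dvd_imp_le not_le zero_less_numeral)
  qed
  then have copK: "coprime q K"
    using assms(1) by (simp add: prime_imp_coprime)
  have disc: "[2 ^ n * kfib K n = 2 * n * K ^ (n - 1)] (mod q)" for n
    using kfib_cong_discriminant assms(3) by (rule cong_dvd_modulus_nat)
  have Ft: "q dvd kfib K t"
    using assms(4) by (simp add: kfib_returns_def)
  have "q dvd 2 * t * K ^ (t - 1)"
    using disc[of t] Ft by (meson cong_dvd_iff dvd_mult cong_0_iff cong_sym cong_trans)
  then have "q dvd t"
    using cop2 copK by (simp add: coprime_dvd_mult_left_iff coprime_dvd_mult_right_iff)
  have "[kfib K (0 + t + 1) = 1] (mod q)"
    using assms(4)[unfolded kfib_returns_iff_period, rule_format, of 1] by (simp add: add.commute)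
  then have "[2 ^ Suc t * kfib K (Suc t) = 2 ^ Suc t * 1] (mod q)"
    by (intro cong_mult cong_refl) simp
  then have "[2 * 2 ^ t = 2 * (Suc t * K ^ t)] (mod q)"
    using disc[of "Suc t"] by (simp add: mult.assoc) (metis cong_sym cong_trans)
  then have "[2 ^ t = Suc t * K ^ t] (mod q)"
    using cop2 by (subst (asm) cong_mult_lcancel_nat) (simp_all only: coprime_commute)
  moreover have "[Suc t * K ^ t = 1 * K ^ t] (mod q)"
    using \<open>q dvd t\<close> cong_add[of t 0 q 1 1] by (intro cong_mult cong_refl) (simp add: cong_0_iff)
  ultimately have pow: "[2 ^ t = K ^ t] (mod q)"
    by (metis cong_trans mult_1)
  obtain s where s: "t = 2 * s"
    using kfib_returns_even[OF assms(4) \<open>q > 2\<close>] by blast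
  have "[int (2 ^ t) = int (K ^ t)] (mod int q)"
    using pow by (simp only: cong_int_iff)
  then have a: "[4 ^ s = (int K ^ 2) ^ s] (mod int q)"
    by (simp add: s power_mult)
  have "int q dvd int (K\<^sup>2 + 4)"
    using assms(3) by (simp only: int_dvd_int_iff)
  then have "[int K ^ 2 = - 4] (mod int q)"
    by (simp add: cong_iff_dvd_diff)
  then have "[(int K ^ 2) ^ s = (- 4) ^ s] (mod int q)"
    by (rule cong_pow)
  with a have b: "[4 ^ s = (- 4 :: int) ^ s] (mod int q)"
    by (rule cong_trans)
  have "even s"
  proof (rule ccontr)
    assume "odd s"
    then have "int q dvd 2 * 4 ^ s"
      using b by (simp add: cong_iff_dvd_diff)
    also have "2 * 4 ^ s = int (2 ^ Suc (2 * s))"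
      by (simp add: power_mult)
    finally have "q dvd 2 ^ Suc (2 * s)"
      by (simp only: int_dvd_int_iff)
    then have "q dvd 2"
      using assms(1) prime_dvd_power by blast
    then show False
      using \<open>q > 2\<close> by (auto dest: dvd_imp_le)
  qed
  then show ?thesis by (auto simp: s elim!: evenE)
qed

text \<open>For odd \<open>K\<close> the parities repeat as even, odd, odd.\<close>

lemma even_kfib_iff:
  assumes "odd K"
  shows "even (kfib K n) \<longleftrightarrow> 3 dvd n"
proof -
  have "(even (kfib K (3 * j)) \<and> odd (kfib K (3 * j + 1))) \<and> odd (kfib K (3 * j + 2))" for j
    using assms by (induction j) (simp_all add: numeral_3_eq_3)
  note j = this[of "n div 3"]
  have "n = 3 * (n div 3) + n mod 3" "n mod 3 < 3"
    by simp_all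
  then consider "n = 3 * (n div 3)" | "n = 3 * (n div 3) + 1" | "n = 3 * (n div 3) + 2"
    by linarith
  then show ?thesis
  proof cases
    case 1
    then show ?thesis using j by (metis dvd_triv_left)
  next
    case 2
    then have "\<not> 3 dvd n" by presburger
    with 2 show ?thesis using j by metis
  next
    case 3
    then have "\<not> 3 dvd n" by presburger
    with 3 show ?thesis using j by metis
  qed
qed

section \<open>Fixed points of the period\<close>

text \<open>The multiplicity of \<open>p\<close> in an lcm of positive numbers is the maximum of the
  multiplicities. The condition \<open>k > 0\<close> excludes empty \<open>A\<close>, where the
  \<open>Lcm\<close> is 1.\<close>

lemma prime_power_dvd_Lcm:
  fixes f :: "'a \<Rightarrow> nat"
  assumes "finite A" "prime p" "\<And>a. a \<in> A \<Longrightarrow> f a > 0" "p ^ k dvd Lcm (f ` A)" "k > 0"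
  shows "\<exists>a\<in>A. p ^ k dvd f a"
  using assms
proof (induction A rule: finite_induct)
  case empty
  then show ?case by auto
next
  case (insert a A)
  have "Lcm (f ` A) \<noteq> 0"
    using insert.hyps(1) insert.prems(2) by (subst Lcm_0_iff) fastforce+
  moreover have "f a \<noteq> 0"
    using insert by auto
  moreover have "p ^ k dvd lcm (f a) (Lcm (f ` A))"
    using insert by simp
  ultimately have "p ^ k dvd f a \<or> p ^ k dvd Lcm (f ` A)"
    using \<open>prime p\<close> prime_gt_1_nat[of p]
    by (auto simp: power_dvd_iff_le_multiplicity multiplicity_lcm le_max_iff_disj)
  then show ?case using insert by auto
qed

text \<open>The lcm \<open>L\<close> of the lifted periods is a period modulo every prime power of
  \<open>m\<close>, hence modulo \<open>m\<close>. A prime power dividing the least period therefore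
  divides \<open>L\<close>, and so the contribution of a single \<open>q\<close>.\<close>

lemma kfib_period_prime_power_dvd:
  assumes "m > 0" and T: "\<And>q. prime q \<Longrightarrow> q dvd m \<Longrightarrow> T q > 0 \<and> kfib_returns K q (T q)"
  shows "kfib_returns K m (kfib_period K m)"
    and "\<lbrakk>prime p; k > 0; p ^ k dvd kfib_period K m\<rbrakk> \<Longrightarrow>
           \<exists>q. prime q \<and> q dvd m \<and> p ^ k dvd q ^ (multiplicity q m - 1) * T q"
proof -
  let ?f = "\<lambda>q. q ^ (multiplicity q m - 1) * T q"
  define L where "L = Lcm (?f ` prime_factors m)"
  have pf: "prime q" "q dvd m" if "q \<in> prime_factors m" for q
    using that by (auto simp: prime_factors_dvd)
  have f_pos: "?f q > 0" if "q \<in> prime_factors m" for q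
    using T[OF pf[OF that]] prime_gt_0_nat[OF pf(1)[OF that]] by simp
  have "L > 0"
    unfolding L_def using f_pos by (intro Nat.gr0I) (fastforce simp: Lcm_0_iff simp del: mult_eq_0_iff)
  have "kfib_returns K (\<Prod>q\<in>prime_factors m. q ^ multiplicity q m) L"
  proof (rule kfib_returns_prod)
    fix q assume q: "q \<in> prime_factors m"
    have "multiplicity q m > 0"
      using q by (simp add: prime_factors_multiplicity)
    then have "Suc (multiplicity q m - 1) = multiplicity q m"
      by simp
    then have "kfib_returns K (q ^ multiplicity q m) (?f q)"
      using kfib_returns_prime_power[of K q "T q" "multiplicity q m - 1"] T[OF pf[OF q]] by simp
    moreover have "?f q dvd L"
      unfolding L_def using q by (intro dvd_Lcm) auto
    ultimately show "kfib_returns K (q ^ multiplicity q m) L"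
      by (rule kfib_returns_dvd)
  next
    fix q r assume "q \<in> prime_factors m" "r \<in> prime_factors m" "q \<noteq> r"
    then show "coprime (q ^ multiplicity q m) (r ^ multiplicity r m)"
      by (intro coprime_power_left_iff[THEN iffD2] coprime_power_right_iff[THEN iffD2] disjI1
          primes_coprime pf)
  qed simp
  then have L: "kfib_returns K m L"
    using prime_factorization_nat[of m] \<open>m > 0\<close> by simp
  show "kfib_returns K m (kfib_period K m)"
    using kfib_period_properties(1)[OF L \<open>L > 0\<close>] .
  assume p: "prime p" "k > 0" "p ^ k dvd kfib_period K m"
  then have "p ^ k dvd L"
    using kfib_period_properties(2)[OF L \<open>L > 0\<close> L] dvd_trans by blast
  then have "\<exists>q\<in>prime_factors m. p ^ k dvd ?f q"
    unfolding L_def using p f_pos by (intro prime_power_dvd_Lcm) auto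
  then show "\<exists>q. prime q \<and> q dvd m \<and> p ^ k dvd ?f q"
    using pf by blast
qed

lemma discriminant_cong_3_mod_6:
  fixes K :: nat
  assumes "[K = 3] (mod 6)"
  shows "odd K" "3 dvd K" "odd (K\<^sup>2 + 4)" "\<not> 3 dvd K\<^sup>2 + 4"
proof -
  have "K mod 6 = 3"
    using assms by (simp add: cong_def)
  then show "odd K" "3 dvd K"
    by presburger+
  then show "odd (K\<^sup>2 + 4)"
    by simp
  have "3 dvd K\<^sup>2"
    using \<open>3 dvd K\<close> by (simp add: power2_eq_square)
  then show "\<not> 3 dvd K\<^sup>2 + 4"
    by presburger
qed

text \<open>Collects the values T(q). The last clause covers T(q) = 2(q - 1) or 2(q + 1), recording
  only what the descent on prime factors needs.\<close>

lemma kfib_returns_prime_exists: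
  assumes "[K = 3] (mod 6)" "prime q"
  shows "\<exists>t>0. kfib_returns K q t \<and> (q = 2 \<longrightarrow> t = 3) \<and> (q = 3 \<longrightarrow> t = 2)
    \<and> (q dvd K\<^sup>2 + 4 \<longrightarrow> t = 4 * q)
    \<and> (q > 3 \<and> \<not> q dvd K\<^sup>2 + 4 \<longrightarrow> (\<forall>p. prime p \<and> p > 3 \<and> p dvd t \<longrightarrow> p < q))"
proof -
  note K = discriminant_cong_3_mod_6[OF assms(1)]
  consider "q = 2" | "q = 3" | "q > 3" "q dvd K\<^sup>2 + 4" | "q > 3" "\<not> q dvd K\<^sup>2 + 4"
    using prime_ge_2_nat[OF assms(2)] by linarith
  then show ?thesis
  proof cases
    case 1
    have "kfib_returns K 2 3"
      unfolding kfib_returns_def by (simp add: K numeral_3_eq_3)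
    then show ?thesis using 1 K by auto
  next
    case 2
    have "3 dvd int K"
      using K(2) by presburger
    then have "kfib_returns K 3 2"
      unfolding kfib_returns_def by (simp add: numeral_2_eq_2)
    then show ?thesis using 2 K by auto
  next
    case 3
    then have "odd q"
      using assms(2) prime_odd_nat by auto
    then show ?thesis
      using kfib_returns_dvd_discriminant[OF assms(2) _ 3(2)] 3 by (intro exI[of _ "4 * q"]) auto
  next
    case 4
    then have "odd q"
      using assms(2) prime_odd_nat by auto
    \<comment> \<open>The odd \<open>p\<close> divides q - 1 or q + 1; it cannot equal the even
      number q + 1, nor \<open>q\<close>, which does not divide q + 1.\<close>
    have small: "p < q" if "prime p" "p > 3" "p dvd 2 * (q - 1) \<or> p dvd 2 * (q + 1)" for p
    proof -
      have "odd p"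
        using that prime_odd_nat by auto
      then have "coprime p 2" by simp
      then have "p dvd q - 1 \<or> p dvd q + 1"
        using that(3) by (simp only: coprime_dvd_mult_right_iff)
      moreover have "p \<noteq> q + 1"
        using \<open>odd p\<close> \<open>odd q\<close> by auto
      moreover have "p \<noteq> q" if "p dvd q + 1"
        using that \<open>p > 3\<close> dvd_add_right_iff[of q q 1] by auto
      ultimately show ?thesis
        using 4(1) dvd_imp_le[of p "q - 1"] dvd_imp_le[of p "q + 1"] by force
    qed
    show ?thesis
      using kfib_returns_not_dvd_discriminant[OF assms(2) \<open>odd q\<close> 4(2)]
    proof
      assume "kfib_returns K q (2 * (q - 1))"
      then show ?thesis
        using small 4 by (intro exI[of _ "2 * (q - 1)"]) auto
    next
      assume "kfib_returns K q (2 * (q + 1))"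
      then show ?thesis
        using small 4 by (intro exI[of _ "2 * (q + 1)"]) auto
    qed
  qed
qed

theorem theorem3p6:
  fixes K m :: nat
  assumes "K \<ge> 1"
    and "[K = 3] (mod 6)"
    and "m > 1"
    and "kfib_period K m = m"
  shows "m = 6 \<or> (\<exists>j :: nat \<Rightarrow> nat. m = 12 * (\<Prod>p \<in> prime_factors (K\<^sup>2 + 4). p ^ j p))"
proof -
  define D where "D = K\<^sup>2 + 4"
  note K = discriminant_cong_3_mod_6[OF assms(2), folded D_def]
  \<comment> \<open>The primality condition moves inside the existential so that
    \<open>choice\<close> yields one function \<open>T\<close> on all numbers.\<close>
  have "\<forall>q. \<exists>t. prime q \<longrightarrow> t > 0 \<and> kfib_returns K q t \<and> (q = 2 \<longrightarrow> t = 3) \<and> (q = 3 \<longrightarrow> t = 2)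
    \<and> (q dvd D \<longrightarrow> t = 4 * q)
    \<and> (q > 3 \<and> \<not> q dvd D \<longrightarrow> (\<forall>p. prime p \<and> p > 3 \<and> p dvd t \<longrightarrow> p < q))"
    using kfib_returns_prime_exists[OF assms(2)] unfolding D_def by blast
  then obtain T where "\<forall>q. prime q \<longrightarrow> T q > 0 \<and> kfib_returns K q (T q)
    \<and> (q = 2 \<longrightarrow> T q = 3) \<and> (q = 3 \<longrightarrow> T q = 2) \<and> (q dvd D \<longrightarrow> T q = 4 * q)
    \<and> (q > 3 \<and> \<not> q dvd D \<longrightarrow> (\<forall>p. prime p \<and> p > 3 \<and> p dvd T q \<longrightarrow> p < q))"
    by (elim choice[THEN exE]) blast
  note T_all = this[rule_format]
  have T: "T q > 0 \<and> kfib_returns K q (T q)" if "prime q" for q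
    using T_all[OF that] by blast
  have T2: "T 2 = 3" and T3: "T 3 = 2"
    using T_all[of 2] T_all[of 3] by simp_all
  have TD: "T q = 4 * q" if "prime q" "q dvd D" for q
    using T_all that by blast
  have TN: "p < q" if "prime q" "q > 3" "\<not> q dvd D" "prime p" "p > 3" "p dvd T q" for q p
    using T_all that by blast
  have "m > 0" using assms(3) by simp
  have ret: "kfib_returns K m m"
    using kfib_period_prime_power_dvd(1)[OF \<open>m > 0\<close>, of T K] T assms(4) by simp
  \<comment> \<open>As \<open>m\<close> is its own period, the full power of \<open>p\<close>
    divides the contribution of some \<open>q\<close>. If \<open>q = p\<close>, cancelling
    \<open>p ^ (k - 1)\<close> would leave \<open>p\<close> dividing \<open>T p\<close>; so
    \<open>q\<close> differs from \<open>p\<close> and its power is coprime to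
    \<open>p\<close>.\<close>
  have source: "\<exists>q. prime q \<and> q dvd m \<and> q \<noteq> p \<and> p ^ multiplicity p m dvd T q"
    if p: "prime p" "p dvd m" "\<not> p dvd T p" for p
  proof -
    define k where "k = multiplicity p m"
    have "k > 0"
      using p \<open>m > 0\<close> by (simp add: k_def prime_multiplicity_gt_zero_iff)
    obtain q where q: "prime q" "q dvd m" "p ^ k dvd q ^ (multiplicity q m - 1) * T q"
      using kfib_period_prime_power_dvd(2)[OF \<open>m > 0\<close>, of T K p k] T assms(4) p \<open>k > 0\<close>
      by (auto simp: k_def multiplicity_dvd)
    have "q \<noteq> p"
    proof
      assume "q = p"
      moreover have "p ^ k = p ^ (k - 1) * p"
        using \<open>k > 0\<close> by (cases k) simp_all
      ultimately have "p ^ (k - 1) * p dvd p ^ (k - 1) * T p"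
        using q(3) by (simp only: k_def)
      then show False
        using p prime_gt_0_nat[OF p(1)] by simp
    qed
    moreover from this have "coprime (p ^ k) (q ^ (multiplicity q m - 1))"
      using p q by (simp add: primes_coprime)
    ultimately show ?thesis
      using q by (auto simp: k_def coprime_dvd_mult_right_iff)
  qed

  \<comment> \<open>The largest prime factor outside \<open>{2, 3}\<close> and the primes of \<open>D\<close> would have to divide \<open>T q\<close>
    for a larger prime factor \<open>q\<close> of the same kind.\<close>
  have primes: "p = 2 \<or> p = 3 \<or> p dvd D" if p: "prime p" "p dvd m" for p
  proof (rule ccontr)
    define S where "S = {p. prime p \<and> p dvd m \<and> p > 3 \<and> \<not> p dvd D}"
    assume "\<not> ?thesis"
    moreover have "p \<ge> 2" using p(1) by (rule prime_ge_2_nat)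
    ultimately have "p \<in> S"
      using p by (auto simp: S_def)
    have "finite S"
      using \<open>m > 0\<close> by (auto simp: S_def intro: finite_subset[OF _ finite_divisors_nat[of m]])
    define r where "r = Max S"
    have "r \<in> S"
      unfolding r_def using \<open>finite S\<close> \<open>p \<in> S\<close> by (intro Max_in) auto
    then have r: "prime r" "r dvd m" "r > 3" "\<not> r dvd D"
      by (auto simp: S_def)
    \<comment> \<open>Otherwise \<open>TN\<close> would give \<open>r < r\<close>, so
      \<open>source\<close> applies to \<open>r\<close>.\<close>
    have "\<not> r dvd T r"
      using TN[of r r] r by auto
    then obtain q where q: "prime q" "q dvd m" "q \<noteq> r" "r ^ multiplicity r m dvd T q"
      using source r by blast
    have "multiplicity r m > 0"
      using r \<open>m > 0\<close> by (simp add: prime_multiplicity_gt_zero_iff)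
    then have rT: "r dvd T q"
      using q(4) by (meson dvd_power dvd_trans)
    have "\<not> q dvd D"
    proof
      assume "q dvd D"
      then have "r dvd 2 ^ 2 * q"
        using TD q rT by simp
      then have "r dvd 2 \<or> r dvd q"
        using r(1) by (metis prime_dvd_mult_iff prime_dvd_power)
      then show False
        using r q by (auto dest: dvd_imp_le primes_dvd_imp_eq)
    qed
    moreover have "q > 3"
      using prime_ge_2_nat[OF q(1)] rT T2 T3 r(3)
      by (cases "q = 2"; cases "q = 3") (auto dest: dvd_imp_le)
    ultimately have "q \<in> S" "r < q"
      using q r rT TN by (auto simp: S_def)
    then show False
      using Max_ge[OF \<open>finite S\<close> \<open>q \<in> S\<close>] by (simp add: r_def)
  qed

  \<comment> \<open>Exponents of 2 and 3 in \<open>m\<close>\<close>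
  have "even m"
  proof (cases "m = 2")
    case False
    then show ?thesis
      using kfib_returns_even[OF ret] assms(3) by simp
  qed simp
  have "3 dvd m"
  proof -
    have "even (kfib K m)"
      using ret \<open>even m\<close> unfolding kfib_returns_def by (metis dvd_trans int_dvd_int_iff)
    then show ?thesis
      using even_kfib_iff[of K m] by (simp add: K)
  qed

  define a where "a = multiplicity 2 m"
  define b where "b = multiplicity 3 m"
  have "a > 0" "b > 0"
    using \<open>even m\<close> \<open>3 dvd m\<close> \<open>m > 0\<close>
    by (auto simp: a_def b_def prime_multiplicity_gt_zero_iff)
  \<comment> \<open>The power of 2 must come from \<open>T 3 = 2\<close> or from
    \<open>T q = 4 * q\<close> with \<open>q\<close> odd.\<close>
  have "a \<le> 2"
  proof -
    obtain q where q: "prime q" "q dvd m" "q \<noteq> 2" "2 ^ a dvd T q"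
      using source[of 2] \<open>even m\<close> T2 by (auto simp: a_def)
    have "2 ^ a dvd (2 ^ 2 :: nat)"
    proof (cases "q = 3")
      case True
      then show ?thesis
        using q(4) T3 by (simp add: dvd_trans[of _ 2 4])
    next
      case False
      then have "q dvd D"
        using primes q by blast
      then have "2 ^ a dvd 4 * q"
        using TD q by simp
      moreover have "coprime (2 ^ a) q"
        using q by (intro coprime_power_left_iff[THEN iffD2] disjI1 primes_coprime) auto
      ultimately show ?thesis
        by (simp add: coprime_dvd_mult_left_iff)
    qed
    then show ?thesis
      by (rule power_dvd_imp_le) simp
  qed
  \<comment> \<open>A prime \<open>q\<close> of D other than 3 has \<open>T q = 4 * q\<close>, prime
    to 3; the power of 3 must come from \<open>T 2 = 3\<close>.\<close>
  have "b = 1"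
  proof -
    obtain q where q: "prime q" "q dvd m" "q \<noteq> 3" "3 ^ b dvd T q"
      using source[of 3] \<open>3 dvd m\<close> T3 by (auto simp: b_def)
    have "q = 2"
    proof (rule ccontr)
      assume "q \<noteq> 2"
      then have "q dvd D"
        using primes q by blast
      then have "3 ^ b dvd 4 * q"
        using TD q by simp
      moreover have "3 dvd (3 ^ b :: nat)"
        using \<open>b > 0\<close> by (simp add: dvd_power)
      ultimately have "3 dvd 4 * q"
        by (rule dvd_trans[rotated])
      then have "3 dvd q"
        by presburger
      then show False
        using q primes_dvd_imp_eq[of 3 q] by simp
    qed
    then have "3 ^ b dvd (3 ^ 1 :: nat)"
      using q T2 by simp
    then have "b \<le> 1"
      by (rule power_dvd_imp_le) simp
    with \<open>b > 0\<close> show ?thesis by simp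
  qed

  \<comment> \<open>Factorization of \<open>m\<close>\<close>
  define R where "R = (\<Prod>p\<in>prime_factors D. p ^ multiplicity p m)"
  have "D > 0" by (simp add: D_def)
  have m_eq: "m = 2 ^ a * 3 * R"
  proof -
    have "m = (\<Prod>p\<in>prime_factors m. p ^ multiplicity p m)"
      using prime_factorization_nat \<open>m > 0\<close> by blast
    \<comment> \<open>Enlarging the index set is harmless: primes not dividing \<open>m\<close> have
      multiplicity 0 and contribute 1.\<close>
    also have "\<dots> = (\<Prod>p\<in>insert 2 (insert 3 (prime_factors D)). p ^ multiplicity p m)"
    proof (rule prod.mono_neutral_left)
      show "prime_factors m \<subseteq> insert 2 (insert 3 (prime_factors D))"
        using primes \<open>D > 0\<close> by (auto simp: prime_factors_dvd)
      show "\<forall>i\<in>insert 2 (insert 3 (prime_factors D)) - prime_factors m. i ^ multiplicity i m = 1"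
        using \<open>m > 0\<close>
        by (auto simp: prime_factors_multiplicity prime_factors_dvd[of D])
    qed simp
    also have "\<dots> = 2 ^ a * (3 ^ b * R)"
    proof -
      have "2 \<notin> prime_factors D" "3 \<notin> prime_factors D"
        using K by (auto dest: in_prime_factors_imp_dvd)
      then show ?thesis
        by (simp add: R_def a_def b_def)
    qed
    finally show ?thesis
      using \<open>b = 1\<close> by simp
  qed
  show ?thesis
  proof (cases "a = 2")
    case True
    then have "m = 12 * (\<Prod>p\<in>prime_factors (K\<^sup>2 + 4). p ^ multiplicity p m)"
      using m_eq unfolding R_def D_def by simp
    then show ?thesis
      by (intro disjI2 exI[of _ "\<lambda>p. multiplicity p m"])
  next
    case False
    then have "a = 1"
      using \<open>a > 0\<close> \<open>a \<le> 2\<close> by simp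
    \<comment> \<open>A prime of D dividing \<open>m\<close> would make 4 divide the period
      \<open>m\<close>, against \<open>a = 1\<close>. Hence \<open>R = 1\<close> and
      \<open>m = 6\<close>.\<close>
    have "multiplicity p m = 0" if p: "p \<in> prime_factors D" for p
    proof (rule ccontr)
      assume "multiplicity p m \<noteq> 0"
      then have "p dvd m"
        by (metis not_dvd_imp_multiplicity_0)
      have "prime p" "p dvd D"
        using p by (auto simp: prime_factors_dvd)
      moreover have "odd p"
        using K(3) \<open>p dvd D\<close> by (metis dvd_trans)
      ultimately have "4 dvd m"
        using four_dvd_if_kfib_returns kfib_returns_modulus_dvd[OF ret \<open>p dvd m\<close>]
        by (simp add: D_def)
      then have "2 ^ 2 dvd m" by simp
      then have "2 \<le> a"
        unfolding a_def using \<open>m > 0\<close> by (intro multiplicity_geI) auto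
      with \<open>a = 1\<close> show False by simp
    qed
    then have "R = 1"
      by (simp add: R_def)
    then show ?thesis
      using m_eq \<open>a = 1\<close> by simp
  qed
qed

end
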